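(* Let $V$ be a Hilbert space over $\mathbb{K}=\mathbb{R}$ or $\mathbb{C}$, let $A_0$ be a densely defined skew-symmetric operator on $V$, let $A:=-A_0^*$, and let $(H_-,H_+,G_-,G_+)$ be a boundary quadruple for $A_0$. The mapping $\Phi\mapsto A_\Phi$ is a bijection between the set of all linear contractions $\Phi:H_-\to H_+$ and the set of all $m$-dissipative extensions of $A_0$.
   Context: Inner products are linear in the first argument (and conjugate-linear in the second if $\mathbb{K}=\mathbb{C}$). An operator $B$ on $V$ is a linear map $B:D(B)\to V$ defined on a linear subspace $D(B)\subset V$. $B$ is an extension of $A_0$ ($A_0\subset B$) if $D(A_0)\subset D(B)$ and $Bx=A_0x$ for $x\in D(A_0)$. $A_0$ is skew-symmetric if $\langle A_0u,v\rangle_V+\langle u,A_0v\rangle_V=0$ for all $u,v\in D(A_0)$. With $A:=-A_0^*$, $D(A)=D(A_0^* )$, one has $A_0\subset A$. An operator $B$ on $V$ is dissipative if $\mathrm{Re}\,\langle Bx,x\rangle_V\le 0$ for all $x\in D(B)$, and $m$-dissipative if it is dissipative and $(\mathrm{Id}-B)D(B)=V$. A boundary quadruple $(H_-,H_+,G_-,G_+)$ for $A_0$ consists of pre-Hilbert spaces $H_-,H_+$ over $\mathbb{K}$ and surjective linear maps $G_-:D(A)\to H_-$, $G_+:D(A)\to H_+$ such that $\langle Au,v\rangle_V+\langle u,Av\rangle_V=\langle G_+u,G_+v\rangle_{H_+}-\langle G_-u,G_-v\rangle_{H_-}$ for all $u,v\in D(A)$, and $\ker G_-+\ker G_+=D(A)$.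 A linear contraction $\Phi:H_-\to H_+$ is a linear map with $\|\Phi x\|_{H_+}\le\|x\|_{H_-}$ for all $x\in H_-$. For such $\Phi$, the operator $A_\Phi$ on $V$ is defined by $D(A_\Phi):=\{w\in D(A):\Phi G_-w=G_+w\}$ and $A_\Phi w:=Aw$. *)

theory Defs
  imports "HOL-Analysis.Analysis"
begin

(* Scalar fields: a type of this class is a copy of the reals or of the complex numbers,
   with real part and conjugation obtained from the embedding into the complex numbers. *)
class real_or_complex = field +
  fixes to_complex :: "'a \<Rightarrow> complex"
  assumes to_complex_add: "to_complex (a + b) = to_complex a + to_complex b"
    and to_complex_mult: "to_complex (a * b) = to_complex a * to_complex b"
    and to_complex_one: "to_complex 1 = 1"
    and range_to_complex: "range to_complex = \<real> \<or> range to_complex = UNIV"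

instantiation real :: real_or_complex
begin
definition "to_complex = complex_of_real"
instance
  by standard (auto simp: to_complex_real_def Reals_def)
end

instantiation complex :: real_or_complex
begin
definition "to_complex = (\<lambda>z :: complex. z)"
instance
  by standard (auto simp: to_complex_complex_def)
end

(* A pre-Hilbert space over 'k. The type's real inner product is the real part of the
   'k-valued one, so norm, topology and completeness of the type are those induced by ip.
   Positive definiteness of ip, and compatibility of scl with scaleR, follow from re_ip. *)
locale pre_hilbert_space = vector_space scl
  for scl :: "'k::real_or_complex \<Rightarrow> 'v::real_inner \<Rightarrow> 'v" +
  fixes ip :: "'v \<Rightarrow> 'v \<Rightarrow> 'k"
  assumes ip_add_left: "ip (x + y) z = ip x z + ip y z"
    and ip_scale_left: "ip (scl c x) y = c * ip x y"
    and ip_conj_sym: "to_complex (ip y x) = cnj (to_complex (ip x y))"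
    and re_ip: "Re (to_complex (ip x y)) = x \<bullet> y"

lemma pre_hilbert_space_real:
  "pre_hilbert_space scaleR (inner :: 'v::real_inner \<Rightarrow> 'v \<Rightarrow> real)"
  by unfold_locales
    (auto simp: to_complex_real_def inner_commute inner_add_left algebra_simps)

lemma pre_hilbert_space_complex:
  "pre_hilbert_space ((*) :: complex \<Rightarrow> complex \<Rightarrow> complex) (\<lambda>x y. x * cnj y)"
  by unfold_locales
    (auto simp: to_complex_complex_def inner_complex_def algebra_simps)

definition linear_on :: "('k::field \<Rightarrow> 'v::ab_group_add \<Rightarrow> 'v) \<Rightarrow> ('k \<Rightarrow> 'w::ab_group_add \<Rightarrow> 'w) \<Rightarrow>
    'v set \<Rightarrow> ('v \<Rightarrow> 'w) \<Rightarrow> bool" where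
  "linear_on s1 s2 D f \<longleftrightarrow>
     (\<forall>x\<in>D. \<forall>y\<in>D. f (x + y) = f x + f y) \<and> (\<forall>c. \<forall>x\<in>D. f (s1 c x) = s2 c (f x))"

(* An operator B is a partial function with domain dom B and value the (B x) at x in dom B.
   Extension of operators is map inclusion, and restriction is restrict_map. *)
definition operator :: "('k::field \<Rightarrow> 'v::ab_group_add \<Rightarrow> 'v) \<Rightarrow> ('v \<rightharpoonup> 'v) \<Rightarrow> bool" where
  "operator scl B \<longleftrightarrow>
     module.subspace scl (dom B) \<and> linear_on scl scl (dom B) (\<lambda>x. the (B x))"

definition densely_defined :: "('v::topological_space \<rightharpoonup> 'v) \<Rightarrow> bool" where
  "densely_defined B \<longleftrightarrow> closure (dom B) = UNIV"

definition skew_symmetric :: "('v \<Rightarrow> 'v \<Rightarrow> 'k::field) \<Rightarrow> ('v \<rightharpoonup> 'v) \<Rightarrow> bool" where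
  "skew_symmetric ip B \<longleftrightarrow>
     (\<forall>u\<in>dom B. \<forall>v\<in>dom B. ip (the (B u)) v + ip u (the (B v)) = 0)"

definition dissipative :: "('v \<Rightarrow> 'v \<Rightarrow> 'k::real_or_complex) \<Rightarrow> ('v \<rightharpoonup> 'v) \<Rightarrow> bool" where
  "dissipative ip B \<longleftrightarrow> (\<forall>x\<in>dom B. Re (to_complex (ip (the (B x)) x)) \<le> 0)"

definition m_dissipative ::
    "('v::ab_group_add \<Rightarrow> 'v \<Rightarrow> 'k::real_or_complex) \<Rightarrow> ('v \<rightharpoonup> 'v) \<Rightarrow> bool" where
  "m_dissipative ip B \<longleftrightarrow> dissipative ip B \<and> (\<lambda>x. x - the (B x)) ` dom B = UNIV"

(* The w below is unique when T is densely defined. *)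
definition adjoint_op :: "('v \<Rightarrow> 'v \<Rightarrow> 'k) \<Rightarrow> ('v \<rightharpoonup> 'v) \<Rightarrow> ('v \<rightharpoonup> 'v)" where
  "adjoint_op ip T = (\<lambda>v.
     if \<exists>w. \<forall>u\<in>dom T. ip (the (T u)) v = ip u w
     then Some (THE w. \<forall>u\<in>dom T. ip (the (T u)) v = ip u w)
     else None)"

definition neg_adjoint ::
    "('v::ab_group_add \<Rightarrow> 'v \<Rightarrow> 'k) \<Rightarrow> ('v \<rightharpoonup> 'v) \<Rightarrow> ('v \<rightharpoonup> 'v)" where
  "neg_adjoint ip T = (\<lambda>v. map_option uminus (adjoint_op ip T v))"

definition ker_on :: "'v set \<Rightarrow> ('v \<Rightarrow> 'w::zero) \<Rightarrow> 'v set" where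
  "ker_on D G = {x \<in> D. G x = 0}"

(* Gm and Gp stand for maps defined on dom A only; their values elsewhere play no role. *)
definition boundary_quadruple ::
    "('k::real_or_complex \<Rightarrow> 'v::real_inner \<Rightarrow> 'v) \<Rightarrow> ('v \<Rightarrow> 'v \<Rightarrow> 'k) \<Rightarrow> ('v \<rightharpoonup> 'v) \<Rightarrow>
     ('k \<Rightarrow> 'm::real_inner \<Rightarrow> 'm) \<Rightarrow> ('m \<Rightarrow> 'm \<Rightarrow> 'k) \<Rightarrow>
     ('k \<Rightarrow> 'p::real_inner \<Rightarrow> 'p) \<Rightarrow> ('p \<Rightarrow> 'p \<Rightarrow> 'k) \<Rightarrow>
     ('v \<Rightarrow> 'm) \<Rightarrow> ('v \<Rightarrow> 'p) \<Rightarrow> bool" where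
  "boundary_quadruple scl ip A0 scl_m ip_m scl_p ip_p Gm Gp \<longleftrightarrow>
     (let A = neg_adjoint ip A0; D = dom A in
        pre_hilbert_space scl_m ip_m \<and> pre_hilbert_space scl_p ip_p \<and>
        linear_on scl scl_m D Gm \<and> Gm ` D = UNIV \<and>
        linear_on scl scl_p D Gp \<and> Gp ` D = UNIV \<and>
        (\<forall>u\<in>D. \<forall>v\<in>D. ip (the (A u)) v + ip u (the (A v)) =
           ip_p (Gp u) (Gp v) - ip_m (Gm u) (Gm v)) \<and>
        {x + y |x y. x \<in> ker_on D Gm \<and> y \<in> ker_on D Gp} = D)"

definition linear_contraction ::
    "('k::field \<Rightarrow> 'm::real_normed_vector \<Rightarrow> 'm) \<Rightarrow> ('k \<Rightarrow> 'p::real_normed_vector \<Rightarrow> 'p) \<Rightarrow>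
     ('m \<Rightarrow> 'p) \<Rightarrow> bool" where
  "linear_contraction scl_m scl_p \<Phi> \<longleftrightarrow>
     Vector_Spaces.linear scl_m scl_p \<Phi> \<and> (\<forall>x. norm (\<Phi> x) \<le> norm x)"

definition boundary_restriction ::
    "('v::ab_group_add \<Rightarrow> 'v \<Rightarrow> 'k) \<Rightarrow> ('v \<rightharpoonup> 'v) \<Rightarrow> ('v \<Rightarrow> 'm) \<Rightarrow> ('v \<Rightarrow> 'p) \<Rightarrow>
     ('m \<Rightarrow> 'p) \<Rightarrow> ('v \<rightharpoonup> 'v)" where
  "boundary_restriction ip A0 Gm Gp \<Phi> =
     (let A = neg_adjoint ip A0 in A |` {w \<in> dom A. \<Phi> (Gm w) = Gp w})"

end

theory Submission
  imports Defs
begin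

text \<open>
  The argument needs only the real parts of the inner products. Green's formula tested on
  \<open>ker G\<^sub>-\<close> shows that \<open>G\<^sub>+\<close> is weakly continuous for the graph norm, so by Baire it is bounded,
  and then \<open>G\<^sub>-\<close> is bounded too. Hence \<open>(Id - A\<^sub>\<Phi>) D(A\<^sub>\<Phi>)\<close> is closed, and it is dense because a
  vector orthogonal to it lies in \<open>ker (Id + A)\<close> and Green's formula makes it zero. For \<open>\<Phi> = 0\<close> this
  shows that \<open>G\<^sub>+\<close> maps \<open>ker (Id - A)\<close> isomorphically onto \<open>H\<^sub>+\<close>, which is therefore complete.

  An m-dissipative extension \<open>B\<close> of \<open>A\<^sub>0\<close> is a restriction of \<open>A\<close>, and dissipativity says that
  \<open>G\<^sub>- w \<mapsto> G\<^sub>+ w\<close> is a contraction on \<open>L = G\<^sub>- D(B)\<close>. To see \<open>L = H\<^sub>-\<close>, approximate \<open>x\<close> by its almost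
  projections \<open>l\<^sub>n\<close> in \<open>L\<close>; by completeness of \<open>H\<^sub>+\<close> their images converge to some \<open>y\<close>, the
  contraction extends by \<open>x \<mapsto> y\<close>, and maximality of \<open>B\<close> puts every \<open>w\<close> with \<open>G\<^sub>- w = x\<close>, \<open>G\<^sub>+ w = y\<close>
  into \<open>D(B)\<close>.
\<close>

subsection \<open>Banach and pre-Hilbert spaces\<close>

text \<open>Baire's theorem on the complete space \<open>S\<close> gives a sublevel set with
  interior, and homogeneity carries the bound from a small ball to all of \<open>S\<close>. It is
  applied to the graph of \<open>A\<close>, with \<open>N\<close> the norm of
  \<open>Gp\<close>.\<close>

lemma seminorm_bounded_if_closed_sublevels:
  fixes S :: "'a::{real_normed_vector,complete_space} set" and N :: "'a \<Rightarrow> real"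
  assumes "subspace S" "closed S"
    and triangle: "\<And>x y. x \<in> S \<Longrightarrow> y \<in> S \<Longrightarrow> N (x + y) \<le> N x + N y"
    and scale: "\<And>r x. x \<in> S \<Longrightarrow> N (r *\<^sub>R x) = \<bar>r\<bar> * N x"
    and closed: "\<And>n::nat. closed {x \<in> S. N x \<le> real n}"
  shows "\<exists>C. \<forall>x\<in>S. N x \<le> C * norm x"
proof -
  let ?F = "\<lambda>n::nat. {x \<in> S. N x \<le> real n}"
  let ?X = "top_of_set S"
  have "0 \<in> S" using \<open>subspace S\<close> by (rule subspace_0)
  have "\<Union>(range ?F) = S"
    using real_arch_simple by auto
  then have "?X interior_of \<Union>(range ?F) \<noteq> {}"
    using \<open>0 \<in> S\<close> interior_of_topspace[of ?X] by force
  moreover have "completely_metrizable_space ?X"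
    using \<open>closed S\<close> completely_metrizable_space_closedin completely_metrizable_space_euclidean
    by (metis closed_closedin)
  moreover have "closedin ?X (?F n)" for n
    using closed[of n] by (metis (lifting) closed_subset mem_Collect_eq subsetI)
  ultimately obtain n where "?X interior_of ?F n \<noteq> {}"
    using Baire_category_alt[of ?X "range ?F"] by auto
  then obtain a U where "openin ?X U" "a \<in> U" "U \<subseteq> ?F n"
    by (auto simp: interior_of_def)
  then obtain e where e: "e > 0" and ball: "ball a e \<inter> S \<subseteq> ?F n"
    unfolding openin_contains_ball by blast
  have a: "a \<in> S" "N a \<le> n" using \<open>a \<in> U\<close> \<open>U \<subseteq> ?F n\<close> by auto
  \<comment> \<open>The vector \<open>r x\<close> has norm \<open>e / 2\<close>, so
    \<open>a + r x\<close> stays in the ball. Both it and \<open>a\<close> have seminorm at most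
    \<open>n\<close>, so \<open>N (r x)\<close> is at most \<open>2 n\<close>; division by
    \<open>r\<close> gives the constant.\<close>
  have "N x \<le> 4 * n / e * norm x" if "x \<in> S" for x
  proof (cases "x = 0")
    case True
    then show ?thesis using scale[OF \<open>0 \<in> S\<close>, of 0] by simp
  next
    case False
    define r where "r = e / 2 / norm x"
    have "r > 0" using False e by (simp add: r_def)
    have rx: "r *\<^sub>R x \<in> S" "a + r *\<^sub>R x \<in> S" "-1 *\<^sub>R a \<in> S"
      using \<open>subspace S\<close> that a by (auto intro: subspace_scale subspace_add subspace_neg)
    have "dist a (a + r *\<^sub>R x) < e"
      using False e by (simp add: dist_norm r_def)
    then have "N (a + r *\<^sub>R x) \<le> n" using ball rx by auto
    moreover have "N (r *\<^sub>R x) \<le> N (a + r *\<^sub>R x) + N (-1 *\<^sub>R a)"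
      using triangle[OF rx(2,3)] by simp
    moreover have "N (-1 *\<^sub>R a) = N a" using scale[OF a(1), of "-1"] by simp
    ultimately have "r * N x \<le> 2 * n"
      using scale[OF that, of r] \<open>r > 0\<close> a by simp
    then show ?thesis using False e by (simp add: r_def field_simps)
  qed
  then show ?thesis by blast
qed

text \<open>A substitute for the orthogonal projection that needs no completeness: near-minimisers of
  the distance to \<open>L\<close> have a remainder that is nearly orthogonal to \<open>L\<close>.\<close>

lemma almost_orthogonal_decomposition:
  fixes x :: "'a::real_inner"
  assumes "subspace L" and "e > 0"
  shows "\<exists>l\<in>L. \<forall>y\<in>L. \<bar>(x - l) \<bullet> y\<bar> \<le> e * norm y"
proof -
  let ?I = "INF l\<in>L. (norm (x - l))\<^sup>2"
  have bdd: "bdd_below ((\<lambda>l. (norm (x - l))\<^sup>2) ` L)"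
    by (rule bdd_belowI[of _ 0]) auto
  have "L \<noteq> {}" using assms(1) subspace_0 by auto
  then obtain l where l: "l \<in> L" "(norm (x - l))\<^sup>2 < ?I + e\<^sup>2"
    using cInf_lessD[of "(\<lambda>l. (norm (x - l))\<^sup>2) ` L" "?I + e\<^sup>2"] \<open>e > 0\<close> by auto
  have "(x - l) \<bullet> y \<le> e * norm y" if "y \<in> L" for y
  proof (cases "y = 0")
    case False
    \<comment> \<open>With this step length, moving \<open>l\<close> by \<open>t y\<close> adds the
      quadratic term \<open>e^2\<close> to the squared distance, which matches the slack
      \<open>e^2\<close> in the near-minimality of \<open>l\<close>.\<close>
    define t where "t = e / norm y"
    have "t > 0" "t * norm y = e" using False \<open>e > 0\<close> by (auto simp: t_def)
    have "l + t *\<^sub>R y \<in> L" using l that assms(1) by (simp add: subspace_add subspace_scale)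
    then have "?I \<le> (norm (x - (l + t *\<^sub>R y)))\<^sup>2" by (rule cINF_lower[OF bdd])
    also have "\<dots> = (norm (x - l))\<^sup>2 - 2 * t * ((x - l) \<bullet> y) + (t * norm y)\<^sup>2"
      unfolding power_mult_distrib power2_norm_eq_inner
      by (simp add: algebra_simps inner_commute power2_eq_square)
    finally have "t * ((x - l) \<bullet> y) \<le> e\<^sup>2"
      using l(2) \<open>t * norm y = e\<close> by simp
    also have "e\<^sup>2 = t * (e * norm y)"
      using \<open>t * norm y = e\<close> by (simp add: power2_eq_square)
    finally show ?thesis using \<open>t > 0\<close> by simp
  qed simp
  note this[of "- y" for y] this
  then have "\<forall>y\<in>L. \<bar>(x - l) \<bullet> y\<bar> \<le> e * norm y"
    using assms(1) by (auto simp: abs_le_iff subspace_neg)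
  then show ?thesis using l(1) by blast
qed

text \<open>The vector \<open>l m - l n\<close> lies in \<open>L\<close> and is a difference of two
  remainders nearly orthogonal to it, so its norm is at most \<open>e n + e m\<close>. No limit is
  claimed, so this also serves the space \<open>H_-\<close>, which is not assumed complete.\<close>

lemma exists_Cauchy_almost_orthogonal:
  fixes x :: "'a::real_inner"
  assumes L: "subspace L"
  obtains l e where "\<And>n. l n \<in> L" "Cauchy l" "\<And>n. e n > 0" "e \<longlonglongrightarrow> (0::real)"
    "\<And>n y. y \<in> L \<Longrightarrow> \<bar>(x - l n) \<bullet> y\<bar> \<le> e n * norm y"
proof -
  define e :: "nat \<Rightarrow> real" where "e n = inverse (Suc n)" for n
  have "e n > 0" for n by (simp add: e_def)
  have "e \<longlonglongrightarrow> 0" unfolding e_def by (rule LIMSEQ_inverse_real_of_nat)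
  obtain l where l: "\<And>n. l n \<in> L" "\<And>n y. y \<in> L \<Longrightarrow> \<bar>(x - l n) \<bullet> y\<bar> \<le> e n * norm y"
    using almost_orthogonal_decomposition[OF L \<open>e _ > 0\<close>] by metis
  have le: "norm (l m - l n) \<le> e n + e m" for m n
  proof (cases "l m = l n")
    case True
    then show ?thesis using \<open>\<And>n. e n > 0\<close> by (simp add: add_nonneg_nonneg less_imp_le)
  next
    case False
    let ?y = "l m - l n"
    have "?y \<in> L" using l L by (simp add: subspace_diff)
    have "norm ?y * norm ?y = ?y \<bullet> ?y" by (simp add: dot_square_norm power2_eq_square)
    also have "\<dots> = (x - l n) \<bullet> ?y - (x - l m) \<bullet> ?y" by (simp add: algebra_simps)
    also have "\<dots> \<le> (e n + e m) * norm ?y"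
      using l(2)[OF \<open>?y \<in> L\<close>, of n] l(2)[OF \<open>?y \<in> L\<close>, of m] by (simp add: algebra_simps)
    finally show ?thesis using False by simp
  qed
  have "Cauchy l"
  proof (rule metric_CauchyI)
    fix r :: real assume "r > 0"
    then obtain M where M: "\<And>n. n \<ge> M \<Longrightarrow> e n < r / 2"
      using order_tendstoD(2)[OF \<open>e \<longlonglongrightarrow> 0\<close>, of "r/2"] by (auto simp: eventually_sequentially)
    have "dist (l m) (l n) < r" if "m \<ge> M" "n \<ge> M" for m n
      using le[of m n] M[OF that(1)] M[OF that(2)] by (simp add: dist_norm)
    then show "\<exists>M. \<forall>m\<ge>M. \<forall>n\<ge>M. dist (l m) (l n) < r" by blast
  qed
  then show ?thesis using that l \<open>\<And>n. e n > 0\<close> \<open>e \<longlonglongrightarrow> 0\<close> by blast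
qed

text \<open>Completeness makes the almost projections converge, closedness keeps their limit in
  \<open>M\<close>, and \<open>x\<close> minus the limit is the wanted vector.\<close>

lemma exists_orthogonal_if_closed_subspace:
  fixes M :: "'a::{real_inner,complete_space} set"
  assumes M: "subspace M" "closed M" "M \<noteq> UNIV"
  shows "\<exists>v. v \<noteq> 0 \<and> (\<forall>y\<in>M. v \<bullet> y = 0)"
proof -
  obtain x where "x \<notin> M" using M by auto
  obtain l e where l: "\<And>n. l n \<in> M" "Cauchy l" "e \<longlonglongrightarrow> (0::real)"
    "\<And>n y. y \<in> M \<Longrightarrow> \<bar>(x - l n) \<bullet> y\<bar> \<le> e n * norm y"
    using exists_Cauchy_almost_orthogonal[OF M(1)] by metis
  obtain p where p: "l \<longlonglongrightarrow> p"
    using Cauchy_convergent[OF l(2)] by (auto simp: convergent_def)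
  then have "p \<in> M" using M(2) l(1) closed_sequentially by blast
  have "(x - p) \<bullet> y = 0" if "y \<in> M" for y
  proof -
    have "(\<lambda>n. \<bar>(x - l n) \<bullet> y\<bar>) \<longlonglongrightarrow> \<bar>(x - p) \<bullet> y\<bar>"
      using p by (intro tendsto_intros)
    moreover have "(\<lambda>n. e n * norm y) \<longlonglongrightarrow> 0 * norm y"
      using l(3) by (intro tendsto_intros)
    ultimately have "\<bar>(x - p) \<bullet> y\<bar> \<le> 0 * norm y"
      using l(4)[OF that] by (intro LIMSEQ_le) auto
    then show ?thesis by simp
  qed
  moreover have "x - p \<noteq> 0" using \<open>x \<notin> M\<close> \<open>p \<in> M\<close> by auto
  ultimately show ?thesis by blast
qed

subsection \<open>Boundary quadruples over the reals\<close>

text \<open>The first assumption says that \<open>A\<close> is minus the adjoint of its restriction to \<open>D0\<close>; together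
  with \<open>D0 \<subseteq> D\<close> it makes that restriction skew-symmetric and (by uniqueness of \<open>w\<close>) densely defined.\<close>

locale real_boundary_quadruple =
  fixes D0 D :: "'v::{real_inner,complete_space} set" and A :: "'v \<Rightarrow> 'v"
    and Gm :: "'v \<Rightarrow> 'm::real_inner" and Gp :: "'v \<Rightarrow> 'p::real_inner"
  assumes A_iff: "\<And>v w. v \<in> D \<and> A v = w \<longleftrightarrow> (\<forall>u\<in>D0. A u \<bullet> v + u \<bullet> w = 0)"
    and D0_subset: "D0 \<subseteq> D"
    and Gm_add: "\<And>u v. u \<in> D \<Longrightarrow> v \<in> D \<Longrightarrow> Gm (u + v) = Gm u + Gm v"
    and Gm_scale: "\<And>r u. u \<in> D \<Longrightarrow> Gm (r *\<^sub>R u) = r *\<^sub>R Gm u"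
    and Gp_add: "\<And>u v. u \<in> D \<Longrightarrow> v \<in> D \<Longrightarrow> Gp (u + v) = Gp u + Gp v"
    and Gp_scale: "\<And>r u. u \<in> D \<Longrightarrow> Gp (r *\<^sub>R u) = r *\<^sub>R Gp u"
    and Gm_surj: "Gm ` D = UNIV" and Gp_surj: "Gp ` D = UNIV"
    and green: "\<And>u v. u \<in> D \<Longrightarrow> v \<in> D \<Longrightarrow> A u \<bullet> v + u \<bullet> A v = Gp u \<bullet> Gp v - Gm u \<bullet> Gm v"
    and ker_decomposition:
      "\<And>u. u \<in> D \<Longrightarrow> \<exists>x\<in>D. \<exists>y\<in>D. Gm x = 0 \<and> Gp y = 0 \<and> u = x + y"
begin

lemma A_add: "u \<in> D \<Longrightarrow> v \<in> D \<Longrightarrow> u + v \<in> D \<and> A (u + v) = A u + A v"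
  using A_iff[of u "A u"] A_iff[of v "A v"] A_iff[of "u + v" "A u + A v"]
  by (simp add: inner_add_right) (smt (verit))

lemma A_scale: "u \<in> D \<Longrightarrow> r *\<^sub>R u \<in> D \<and> A (r *\<^sub>R u) = r *\<^sub>R A u"
  using A_iff[of u "A u"] A_iff[of "r *\<^sub>R u" "r *\<^sub>R A u"]
  by (simp add: ring_distribs(1)[symmetric])

lemma zero_D: "0 \<in> D" and A_0: "A 0 = 0"
  using A_iff[of 0 0] by auto

lemma subspace_D: "subspace D"
  by (simp add: subspace_def A_add A_scale zero_D)

lemma diff_D: "u \<in> D \<Longrightarrow> v \<in> D \<Longrightarrow> u - v \<in> D"
  by (rule subspace_diff[OF subspace_D])

lemma A_diff: "u \<in> D \<Longrightarrow> v \<in> D \<Longrightarrow> A (u - v) = A u - A v"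
  using A_add[of u "-1 *\<^sub>R v"] A_scale[of v "-1"] by auto

lemma Gm_diff: "u \<in> D \<Longrightarrow> v \<in> D \<Longrightarrow> Gm (u - v) = Gm u - Gm v"
  using Gm_add[of u "-1 *\<^sub>R v"] Gm_scale[of v "-1"] A_scale[of v "-1"] by auto

lemma Gp_diff: "u \<in> D \<Longrightarrow> v \<in> D \<Longrightarrow> Gp (u - v) = Gp u - Gp v"
  using Gp_add[of u "-1 *\<^sub>R v"] Gp_scale[of v "-1"] A_scale[of v "-1"] by auto

lemma green_quadratic: "u \<in> D \<Longrightarrow> 2 * (A u \<bullet> u) = (norm (Gp u))\<^sup>2 - (norm (Gm u))\<^sup>2"
  using green[of u u] by (simp add: inner_commute power2_norm_eq_inner)

text \<open>This is the link between dissipativity of an operator and the contraction property of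
  the map on boundary values.\<close>

lemma dissipative_at_iff: "u \<in> D \<Longrightarrow> A u \<bullet> u \<le> 0 \<longleftrightarrow> norm (Gp u) \<le> norm (Gm u)"
proof -
  assume "u \<in> D"
  then have "A u \<bullet> u \<le> 0 \<longleftrightarrow> (norm (Gp u))\<^sup>2 \<le> (norm (Gm u))\<^sup>2"
    using green_quadratic[of u] by linarith
  then show ?thesis by simp
qed

section \<open>Attainable boundary values\<close>

text \<open>Removing the \<open>ker Gp\<close> component from a preimage of \<open>p\<close> leaves
  its \<open>Gp\<close> value unchanged.\<close>

lemma Gp_onto_on_ker_Gm: "\<exists>u\<in>D. Gm u = 0 \<and> Gp u = p"
proof -
  obtain u where "u \<in> D" "Gp u = p" using Gp_surj by (metis UNIV_I imageE)
  then show ?thesis using ker_decomposition[of u] Gp_add by fastforce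
qed

lemma Gm_onto_on_ker_Gp: "\<exists>u\<in>D. Gp u = 0 \<and> Gm u = m"
proof -
  obtain u where "u \<in> D" "Gm u = m" using Gm_surj by (metis UNIV_I imageE)
  then show ?thesis using ker_decomposition[of u] Gm_add by fastforce
qed

text \<open>An element of \<open>ker Gm\<close> plus one of \<open>ker Gp\<close> realises both
  values. This later recovers \<open>\<Phi>\<close> from its operator and supplies elements with
  chosen boundary data.\<close>

lemma jointly_surj: "\<exists>u\<in>D. Gm u = m \<and> Gp u = p"
proof -
  obtain u v where "u \<in> D" "Gm u = 0" "Gp u = p" "v \<in> D" "Gp v = 0" "Gm v = m"
    using Gp_onto_on_ker_Gm Gm_onto_on_ker_Gp by meson
  then show ?thesis using Gm_add[of u v] Gp_add[of u v] A_add by (intro bexI[of _ "u + v"]) auto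
qed

text \<open>For \<open>u\<close> in \<open>D0\<close> the left side of Green's formula vanishes
  against all of \<open>D\<close>, because \<open>A\<close> is minus the adjoint. Testing on
  \<open>ker Gm\<close> and on \<open>ker Gp\<close> separates the two boundary terms.\<close>

lemma G_eq_0_if_D0:
  assumes "u \<in> D0" shows "Gm u = 0 \<and> Gp u = 0"
proof -
  have u: "u \<in> D" using assms D0_subset by auto
  have *: "Gp u \<bullet> Gp v = Gm u \<bullet> Gm v" if "v \<in> D" for v
    using A_iff[of v "A v"] green[OF u that] assms that by auto
  obtain v w where "v \<in> D" "Gm v = 0" "Gp v = Gp u" "w \<in> D" "Gp w = 0" "Gm w = Gm u"
    using Gp_onto_on_ker_Gm Gm_onto_on_ker_Gp by meson
  then show ?thesis using *[of v] *[of w] by auto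
qed

section \<open>Closedness of \<open>A\<close> and continuity of the boundary maps\<close>

lemma A_closed:
  assumes "\<And>n. u n \<in> D" "u \<longlonglongrightarrow> v" "(\<lambda>n. A (u n)) \<longlonglongrightarrow> w"
  shows "v \<in> D \<and> A v = w"
  unfolding A_iff
proof
  fix x assume "x \<in> D0"
  have "(\<lambda>n. A x \<bullet> u n + x \<bullet> A (u n)) \<longlonglongrightarrow> A x \<bullet> v + x \<bullet> w"
    using assms by (intro tendsto_intros)
  moreover have "A x \<bullet> u n + x \<bullet> A (u n) = 0" for n
    using A_iff[of "u n" "A (u n)"] assms(1) \<open>x \<in> D0\<close> by blast
  ultimately show "A x \<bullet> v + x \<bullet> w = 0" by (simp add: LIMSEQ_const_iff)
qed

text \<open>Through the product norm, estimates in \<open>graph_norm\<close> are estimates on the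
  graph of \<open>A\<close>, a closed subspace of a complete space.\<close>

definition graph_norm :: "'v \<Rightarrow> real" where "graph_norm u = norm (u, A u)"

text \<open>By Green's formula on \<open>ker Gm\<close>, the functionals \<open>\<lambda>u. Gp u \<bullet> p\<close> are continuous for the graph
  norm, so the sublevel sets of \<open>norm (Gp u)\<close> are closed.\<close>

lemma Gp_bounded: "\<exists>C\<ge>0. \<forall>u\<in>D. norm (Gp u) \<le> C * graph_norm u"
proof -
  let ?S = "(\<lambda>u. (u, A u)) ` D"
  let ?N = "\<lambda>z. norm (Gp (fst z))"
  have S_lim: "z \<in> ?S \<and> (\<exists>u. (\<forall>n. u n \<in> D \<and> s n = (u n, A (u n))) \<and>
      u \<longlonglongrightarrow> fst z \<and> (\<lambda>n. A (u n)) \<longlonglongrightarrow> snd z)"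
    if "\<forall>n. s n \<in> ?S" "s \<longlonglongrightarrow> z" for s z
  proof -
    define u where "u n = fst (s n)" for n
    have s: "u n \<in> D" "s n = (u n, A (u n))" for n
      using that(1)[rule_format, of n] by (auto simp: u_def)
    have "(\<lambda>n. snd (s n)) = (\<lambda>n. A (u n))" using s by (metis snd_conv)
    then have lim: "u \<longlonglongrightarrow> fst z" "(\<lambda>n. A (u n)) \<longlonglongrightarrow> snd z"
      using tendsto_fst[OF that(2)] tendsto_snd[OF that(2)] by (simp_all add: u_def[abs_def])
    have "z \<in> ?S"
      using A_closed[OF s(1) lim] by (auto simp: image_iff prod_eq_iff)
    then show ?thesis using s lim by (intro conjI exI[of _ u]) auto
  qed
  have "\<exists>C. \<forall>z\<in>?S. ?N z \<le> C * norm z"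
  proof (rule seminorm_bounded_if_closed_sublevels)
    show "subspace ?S"
      unfolding subspace_def using A_add A_scale zero_D A_0
      by (auto simp: image_iff zero_prod_def)
    show "closed ?S"
      unfolding closed_sequential_limits using S_lim by blast
    show "?N (x + y) \<le> ?N x + ?N y" if "x \<in> ?S" "y \<in> ?S" for x y
      using that by (auto simp: Gp_add norm_triangle_ineq)
    show "?N (r *\<^sub>R x) = \<bar>r\<bar> * ?N x" if "x \<in> ?S" for r x
      using that by (auto simp: Gp_scale)
    show "closed {z \<in> ?S. ?N z \<le> real k}" for k
      unfolding closed_sequential_limits
    proof (intro allI impI, elim conjE)
      fix s z assume s: "\<forall>n. s n \<in> {z \<in> ?S. ?N z \<le> real k}" "s \<longlonglongrightarrow> z"
      then obtain u where u: "\<And>n. u n \<in> D" "u \<longlonglongrightarrow> fst z" "(\<lambda>n. A (u n)) \<longlonglongrightarrow> snd z"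
        "\<And>n. s n = (u n, A (u n))" and "z \<in> ?S"
        using S_lim[of s z] by blast
      obtain w where w: "w \<in> D" "z = (w, A w)" using \<open>z \<in> ?S\<close> by blast
      have le: "norm (Gp (u n)) \<le> real k" for n using s(1)[rule_format, of n] u(4)[of n] by simp
      \<comment> \<open>The test element carries the boundary value of the limit itself, so the
        limiting inequality bounds the square of \<open>norm (Gp w)\<close> by
        \<open>k * norm (Gp w)\<close>.\<close>
      obtain v where v: "v \<in> D" "Gm v = 0" "Gp v = Gp w" using Gp_onto_on_ker_Gm by meson
      have "(\<lambda>n. A (u n) \<bullet> v + u n \<bullet> A v) \<longlonglongrightarrow> A w \<bullet> v + w \<bullet> A v"
        using u w by (intro tendsto_intros) auto
      then have "(\<lambda>n. Gp (u n) \<bullet> Gp w) \<longlonglongrightarrow> Gp w \<bullet> Gp w"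
        using green[OF u(1) v(1)] green[OF w(1) v(1)] v by simp
      moreover have "Gp (u n) \<bullet> Gp w \<le> real k * norm (Gp w)" for n
        using norm_cauchy_schwarz[of "Gp (u n)" "Gp w"] mult_right_mono[OF le, of "norm (Gp w)" n] by simp
      ultimately have "Gp w \<bullet> Gp w \<le> real k * norm (Gp w)"
        using LIMSEQ_le_const2 by blast
      then have "norm (Gp w) \<le> real k"
        by (cases "Gp w = 0") (simp_all add: dot_square_norm power2_eq_square)
      then show "z \<in> {z \<in> ?S. ?N z \<le> real k}" using \<open>z \<in> ?S\<close> w by simp
    qed
  qed
  then obtain C where C: "\<forall>u\<in>D. norm (Gp u) \<le> C * graph_norm u" by (auto simp: graph_norm_def)
  moreover have "C * graph_norm u \<le> max C 0 * graph_norm u" for u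
    by (simp add: graph_norm_def mult_right_mono)
  ultimately show ?thesis by (intro exI[of _ "max C 0"]) (auto intro: order_trans)
qed

text \<open>Green's formula with both arguments equal to \<open>u\<close> expresses the square of
  \<open>norm (Gm u)\<close> through \<open>Gp u\<close> and \<open>A u \<bullet> u\<close>, both
  controlled by the graph norm.\<close>

lemma Gm_bounded: "\<exists>C. \<forall>u\<in>D. norm (Gm u) \<le> C * graph_norm u"
proof -
  obtain C where C: "C \<ge> 0" "\<forall>u\<in>D. norm (Gp u) \<le> C * graph_norm u" using Gp_bounded by auto
  have "norm (Gm u) \<le> (C + 2) * graph_norm u" if u: "u \<in> D" for u
  proof (rule power2_le_imp_le)
    let ?g = "graph_norm u"
    have g: "norm u \<le> ?g" "norm (A u) \<le> ?g" "?g \<ge> 0"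
      using norm_fst_le[of "(u, A u)"] norm_snd_le[of "(A u)" "u"] by (auto simp: graph_norm_def norm_fst_le norm_snd_le)
    have "(norm (Gm u))\<^sup>2 = (norm (Gp u))\<^sup>2 - 2 * (A u \<bullet> u)" using green_quadratic[OF u] by simp
    also have "\<dots> \<le> (C * ?g)\<^sup>2 + 2 * (?g * ?g)"
    proof -
      have "(norm (Gp u))\<^sup>2 \<le> (C * ?g)\<^sup>2" using C u by (simp add: power_mono)
      moreover have "\<bar>A u \<bullet> u\<bar> \<le> norm (A u) * norm u" by (rule Cauchy_Schwarz_ineq2)
      moreover have "norm (A u) * norm u \<le> ?g * ?g" using g by (intro mult_mono) auto
      ultimately show ?thesis by linarith
    qed
    also have "\<dots> \<le> ((C + 2) * ?g)\<^sup>2"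
      using C(1) g(3) by (simp add: power2_eq_square algebra_simps)
    finally show "(norm (Gm u))\<^sup>2 \<le> ((C + 2) * ?g)\<^sup>2" .
    show "0 \<le> (C + 2) * ?g" using C(1) g(3) by simp
  qed
  then show ?thesis by blast
qed

lemma graph_norm_tendsto_0:
  assumes "\<And>n. u n \<in> D" "v \<in> D" "u \<longlonglongrightarrow> v" "(\<lambda>n. A (u n)) \<longlonglongrightarrow> A v"
  shows "(\<lambda>n. graph_norm (u n - v)) \<longlonglongrightarrow> 0"
proof -
  have "(\<lambda>n. norm ((u n, A (u n)) - (v, A v))) \<longlonglongrightarrow> 0"
    using assms by (intro tendsto_norm_zero LIM_zero tendsto_Pair)
  then show ?thesis using assms by (simp add: graph_norm_def A_diff)
qed

lemma G_tendsto:
  assumes "\<And>n. u n \<in> D" "v \<in> D" "u \<longlonglongrightarrow> v" "(\<lambda>n. A (u n)) \<longlonglongrightarrow> A v"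
  shows "(\<lambda>n. Gm (u n)) \<longlonglongrightarrow> Gm v" "(\<lambda>n. Gp (u n)) \<longlonglongrightarrow> Gp v"
proof -
  note lim = graph_norm_tendsto_0[OF assms]
  obtain C where C: "\<forall>u\<in>D. norm (Gm u) \<le> C * graph_norm u" using Gm_bounded by auto
  have "(\<lambda>n. Gm (u n) - Gm v) \<longlonglongrightarrow> 0"
    by (rule Lim_null_comparison[OF _ tendsto_mult_right_zero[OF lim, of C]])
      (use C assms diff_D in \<open>auto simp: Gm_diff[symmetric]\<close>)
  then show "(\<lambda>n. Gm (u n)) \<longlonglongrightarrow> Gm v" by (rule LIM_zero_cancel)
  obtain C where C: "\<forall>u\<in>D. norm (Gp u) \<le> C * graph_norm u" using Gp_bounded by auto
  have "(\<lambda>n. Gp (u n) - Gp v) \<longlonglongrightarrow> 0"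
    by (rule Lim_null_comparison[OF _ tendsto_mult_right_zero[OF lim, of C]])
      (use C assms diff_D in \<open>auto simp: Gp_diff[symmetric]\<close>)
  then show "(\<lambda>n. Gp (u n)) \<longlonglongrightarrow> Gp v" by (rule LIM_zero_cancel)
qed

section \<open>Surjectivity of \<open>Id - A\<close> under a contractive boundary condition, and
  completeness of \<open>H_+\<close>\<close>

text \<open>The range of \<open>Id - A\<^sub>\<Phi>\<close> is closed by dissipativity and the continuity of the boundary maps.  A
  vector \<open>v\<close> orthogonal to it satisfies \<open>A v = - v\<close>, and Green's formula forces
  \<open>norm (Gm v) \<le> norm (Gp v)\<close>, hence \<open>- 2 * (norm v)\<^sup>2 \<ge> 0\<close>.\<close>

lemma range_Id_minus_A_contraction:
  assumes lin: "linear \<Phi>" and contr: "\<And>x. norm (\<Phi> x) \<le> norm x"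
  shows "\<exists>w\<in>D. \<Phi> (Gm w) = Gp w \<and> w - A w = f"
proof -
  let ?E = "{w \<in> D. \<Phi> (Gm w) = Gp w}"
  let ?M = "(\<lambda>w. w - A w) ` ?E"
  have sub: "subspace ?E"
    using zero_D A_add A_scale Gm_scale[OF zero_D, of 0] Gp_scale[OF zero_D, of 0] lin
    by (auto simp: subspace_def linear_0 linear_add linear_scale Gm_add Gp_add Gm_scale Gp_scale)
  have norm_le: "norm w \<le> norm (w - A w)" if "w \<in> ?E" for w
  proof -
    have "A w \<bullet> w \<le> 0" using dissipative_at_iff[of w] that contr[of "Gm w"] by simp
    then have "norm w * norm w \<le> (w - A w) \<bullet> w"
      by (simp add: inner_diff_left dot_square_norm power2_eq_square)
    also have "\<dots> \<le> norm (w - A w) * norm w" by (rule norm_cauchy_schwarz)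
    finally show ?thesis by (cases "w = 0") auto
  qed
  have "?M = UNIV"
  proof (rule ccontr)
    assume "?M \<noteq> UNIV"
    have "subspace ?M"
    proof (rule subspaceI)
      show "0 \<in> ?M" using subspace_0[OF sub] A_0 by (force simp: image_iff)
    next
      fix x y assume "x \<in> ?M" "y \<in> ?M"
      then obtain a b where "a \<in> ?E" "x = a - A a" "b \<in> ?E" "y = b - A b" by blast
      then show "x + y \<in> ?M" using subspace_add[OF sub, of a b] A_add[of a b]
        by (intro image_eqI[of _ _ "a + b"]) auto
    next
      fix x c assume "x \<in> ?M"
      then obtain a where "a \<in> ?E" "x = a - A a" by blast
      then show "c *\<^sub>R x \<in> ?M" using subspace_scale[OF sub, of a c] A_scale[of a c]
        by (intro image_eqI[of _ _ "c *\<^sub>R a"]) (auto simp: scaleR_diff_right)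
    qed
    have "closed ?M"
      unfolding closed_sequential_limits
    proof (intro allI impI, elim conjE)
      fix s f assume s: "\<forall>n. s n \<in> ?M" "s \<longlonglongrightarrow> f"
      then have "\<forall>n. \<exists>w. w \<in> ?E \<and> s n = w - A w" by blast
      from choice[OF this] obtain w where w: "\<And>n. w n \<in> ?E" "\<And>n. s n = w n - A (w n)"
        by blast
      have "dist (w m) (w n) \<le> dist (s m) (s n)" for m n
      proof -
        have "s m - s n = (w m - w n) - A (w m - w n)" using w by (simp add: A_diff)
        then show ?thesis
          using norm_le[OF subspace_diff[OF sub w(1) w(1)], of m n] by (simp only: dist_norm)
      qed
      then have "Cauchy w"
        using LIMSEQ_imp_Cauchy[OF s(2)] unfolding Cauchy_def by (meson order_le_less_trans)
      then obtain v where v: "w \<longlonglongrightarrow> v" using Cauchy_convergent convergent_def by blast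
      have Aw: "(\<lambda>n. A (w n)) \<longlonglongrightarrow> v - f"
        using tendsto_diff[OF v s(2)] w(2) by simp
      have vD: "v \<in> D \<and> A v = v - f" using A_closed[OF _ v Aw] w(1) by blast
      then have G: "(\<lambda>n. Gm (w n)) \<longlonglongrightarrow> Gm v" "(\<lambda>n. Gp (w n)) \<longlonglongrightarrow> Gp v"
        using G_tendsto[OF _ _ v] w(1) Aw by auto
      have "bounded_linear \<Phi>"
        using lin contr by (auto intro!: bounded_linear_intro[of \<Phi> 1] simp: linear_add linear_scale)
      from bounded_linear.tendsto[OF this G(1)] have "(\<lambda>n. Gp (w n)) \<longlonglongrightarrow> \<Phi> (Gm v)"
        using w(1) by simp
      then have "\<Phi> (Gm v) = Gp v" using G(2) LIMSEQ_unique by blast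
      then show "f \<in> ?M" using vD by (intro image_eqI[of _ _ v]) auto
    qed
    from exists_orthogonal_if_closed_subspace[OF \<open>subspace ?M\<close> \<open>closed ?M\<close> \<open>?M \<noteq> UNIV\<close>]
    obtain v where "v \<noteq> 0" and v: "\<And>w. w \<in> ?E \<Longrightarrow> v \<bullet> (w - A w) = 0"
      by blast
    have "\<forall>u\<in>D0. A u \<bullet> v + u \<bullet> - v = 0"
    proof
      fix u assume "u \<in> D0"
      then have "u \<in> ?E" using G_eq_0_if_D0 D0_subset lin linear_0 by fastforce
      then show "A u \<bullet> v + u \<bullet> - v = 0"
        using v[of u] by (simp add: inner_diff_right inner_commute)
    qed
    then have vD: "v \<in> D" "A v = - v" using A_iff[of v "- v"] by auto
    \<comment> \<open>This \<open>w\<close> satisfies the boundary condition, so \<open>v\<close> is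
      orthogonal to \<open>w - A w\<close>. With \<open>A v = - v\<close> the left side of Green's
      formula for \<open>w\<close> and \<open>v\<close> vanishes.\<close>
    obtain w where w: "w \<in> D" "Gm w = Gm v" "Gp w = \<Phi> (Gm v)" using jointly_surj by meson
    have "A w \<bullet> v + w \<bullet> A v = 0"
      using v[of w] w vD by (simp add: inner_diff_right inner_commute)
    then have "Gm v \<bullet> Gm v = \<Phi> (Gm v) \<bullet> Gp v" using green[OF w(1) vD(1)] w by simp
    also have "\<dots> \<le> norm (\<Phi> (Gm v)) * norm (Gp v)" by (rule norm_cauchy_schwarz)
    also have "\<dots> \<le> norm (Gm v) * norm (Gp v)" by (simp add: contr mult_right_mono)
    finally have "norm (Gm v) \<le> norm (Gp v)"
      by (cases "Gm v = 0") (auto simp: dot_square_norm power2_eq_square)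
    then have "(norm (Gm v))\<^sup>2 \<le> (norm (Gp v))\<^sup>2" by (simp add: power_mono)
    moreover have "A v \<bullet> v < 0" using vD(2) \<open>v \<noteq> 0\<close> by simp
    ultimately show False using green_quadratic[OF vD(1)] by linarith
  qed
  then have "f \<in> ?M" by simp
  then show ?thesis by blast
qed

text \<open>\<open>Gp\<close> is an isomorphism from the closed subspace \<open>{h. A h = h}\<close> onto its codomain.\<close>

lemma Cauchy_Gp_convergent:
  fixes y :: "nat \<Rightarrow> 'p"
  assumes "Cauchy y"
  shows "convergent y"
proof -
  have "\<exists>h. h \<in> D \<and> A h = h \<and> Gp h = p" for p
  proof -
    obtain u where u: "u \<in> D" "Gp u = p" using Gp_surj by (metis UNIV_I imageE)
    \<comment> \<open>Taking \<open>\<Phi> = 0\<close> gives a \<open>w\<close> with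
      \<open>Gp w = 0\<close>, so \<open>u - w\<close> lies in \<open>ker (Id - A)\<close> and has
      the same \<open>Gp\<close> value as \<open>u\<close>.\<close>
    obtain w where "w \<in> D" "Gp w = 0" "w - A w = u - A u"
      using range_Id_minus_A_contraction[of "\<lambda>_. 0" "u - A u"] by (auto simp: linear_zero)
    then show ?thesis
      using u by (intro exI[of _ "u - w"]) (auto simp: A_diff Gp_diff diff_D algebra_simps)
  qed
  then have "\<forall>n. \<exists>h. h \<in> D \<and> A h = h \<and> Gp h = y n" by simp
  from choice[OF this] obtain h
    where h: "\<And>n. h n \<in> D" "\<And>n. A (h n) = h n" "\<And>n. Gp (h n) = y n" by blast
  have "dist (h m) (h n) \<le> dist (y m) (y n)" for m n
  proof -
    let ?d = "h m - h n"
    \<comment> \<open>On \<open>ker (Id - A)\<close> the left side of Green's formula is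
      \<open>2 |d|^2\<close>; dropping the \<open>Gm\<close> term shows that \<open>Gp\<close> does
      not shrink norms there, so Cauchy sequences lift.\<close>
    have "2 * (norm ?d)\<^sup>2 \<le> (norm (Gp ?d))\<^sup>2"
      using green_quadratic[of ?d] h by (simp add: diff_D A_diff power2_norm_eq_inner)
    then have "(norm ?d)\<^sup>2 \<le> (norm (Gp ?d))\<^sup>2" by (smt (verit) zero_le_power2)
    then show ?thesis using h by (simp add: Gp_diff dist_norm)
  qed
  then have "Cauchy h"
    using assms unfolding Cauchy_def by (meson order_le_less_trans)
  then obtain v where v: "h \<longlonglongrightarrow> v" using Cauchy_convergent convergent_def by blast
  then have "v \<in> D \<and> A v = v" using A_closed[of h v v] h by simp
  then have "y \<longlonglongrightarrow> Gp v" using G_tendsto(2)[of h v] h v by simp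
  then show ?thesis by (auto simp: convergent_def)
qed

section \<open>From m-dissipative extensions to contractions\<close>

text \<open>Choose \<open>b\<close> in \<open>E\<close> with \<open>w - A w = b - A b\<close>. Then
  \<open>A\<close> fixes \<open>w - b\<close>, while the boundary estimate makes
  \<open>A (w - b) \<bullet> (w - b)\<close> nonpositive, so \<open>w = b\<close>.\<close>

lemma mem_if_maximal:
  assumes onto: "(\<lambda>w. w - A w) ` E = UNIV" and "E \<subseteq> D" and "w \<in> D"
    and le: "\<And>b. b \<in> E \<Longrightarrow> norm (Gp (w - b)) \<le> norm (Gm (w - b))"
  shows "w \<in> E"
proof -
  obtain b where b: "b \<in> E" "w - A w = b - A b" using onto by (metis UNIV_I imageE)
  have bD: "b \<in> D" using b assms by auto
  have "A (w - b) = w - b" using b by (simp add: A_diff assms bD algebra_simps)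
  then have "(w - b) \<bullet> (w - b) \<le> 0"
    using dissipative_at_iff[OF diff_D[OF \<open>w \<in> D\<close> bD]] le[OF b(1)] by simp
  then have "w - b = 0" using inner_gt_zero_iff[of "w - b"] by linarith
  then show ?thesis using b by simp
qed

lemma Gm_onto_if_m_dissipative:
  assumes E: "subspace E" "E \<subseteq> D" and diss: "\<And>w. w \<in> E \<Longrightarrow> A w \<bullet> w \<le> 0"
    and onto: "(\<lambda>w. w - A w) ` E = UNIV"
  shows "Gm ` E = UNIV"
proof -
  have le: "norm (Gp w) \<le> norm (Gm w)" if "w \<in> E" for w
    using dissipative_at_iff[of w] diss[OF that] that E(2) by blast
  have L: "subspace (Gm ` E)"
  proof (rule subspaceI)
    show "0 \<in> Gm ` E" using Gm_scale[OF zero_D, of 0] subspace_0[OF E(1)] by force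
  next
    fix x y assume "x \<in> Gm ` E" "y \<in> Gm ` E"
    then obtain a b where "a \<in> E" "x = Gm a" "b \<in> E" "y = Gm b" by blast
    then have "Gm (a + b) = x + y" "a + b \<in> E"
      using subspace_add[OF E(1), of a b] E(2) Gm_add[of a b] by (auto simp: subset_iff)
    then show "x + y \<in> Gm ` E" by (metis imageI)
  next
    fix x c assume "x \<in> Gm ` E"
    then obtain a where "a \<in> E" "x = Gm a" by blast
    then have "Gm (c *\<^sub>R a) = c *\<^sub>R x" "c *\<^sub>R a \<in> E"
      using subspace_scale[OF E(1), of a c] E(2) Gm_scale[of a c] by (auto simp: subset_iff)
    then show "c *\<^sub>R x \<in> Gm ` E" by (metis imageI)
  qed
  have "x \<in> Gm ` E" for x
  proof -
    obtain l e where l: "\<And>n. l n \<in> Gm ` E" "Cauchy l" "e \<longlonglongrightarrow> (0::real)"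
      "\<And>n y. y \<in> Gm ` E \<Longrightarrow> \<bar>(x - l n) \<bullet> y\<bar> \<le> e n * norm y" and epos: "\<And>n. e n > 0"
      using exists_Cauchy_almost_orthogonal[OF L] by metis
    define b where "b n = inv_into E Gm (l n)" for n
    have b: "b n \<in> E" "l n = Gm (b n)" for n
      using l(1)[of n] by (simp_all add: b_def inv_into_into f_inv_into_f)
    have le_b: "norm (Gp a - Gp (b n)) \<le> norm (Gm a - l n)" if "a \<in> E" for a n
      using le[OF subspace_diff[OF E(1) that b(1)], of n] b that E(2)
      by (simp add: Gp_diff Gm_diff subset_iff)
    have "dist (Gp (b m)) (Gp (b n)) \<le> dist (l m) (l n)" for m n
      using le_b[OF b(1)] b by (simp add: dist_norm)
    then have "Cauchy (\<lambda>n. Gp (b n))"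
      using l(2) unfolding Cauchy_def by (meson order_le_less_trans)
    then obtain y where y: "(\<lambda>n. Gp (b n)) \<longlonglongrightarrow> y"
      using Cauchy_Gp_convergent convergent_def by blast
    obtain w where w: "w \<in> D" "Gm w = x" "Gp w = y" using jointly_surj by meson
    have "w \<in> E"
    proof (rule mem_if_maximal[OF onto E(2) w(1)])
      fix a assume a: "a \<in> E"
      \<comment> \<open>The remainder \<open>x - l n\<close> need not be small, but it is nearly
        orthogonal to \<open>?q\<close> in \<open>L\<close>. Hence \<open>Gm a\<close> is no farther
        from \<open>l n\<close> than from \<open>x\<close>, up to \<open>e n\<close>.\<close>
      have "norm (Gp a - Gp (b n)) \<le> norm (Gm a - x) + e n" for n
      proof -
        let ?q = "Gm a - l n"
        have q: "?q \<in> Gm ` E" using a b(1) l(1) by (intro subspace_diff[OF L]) auto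
        have "norm ?q * norm ?q = (Gm a - x) \<bullet> ?q + (x - l n) \<bullet> ?q"
          by (simp add: dot_square_norm[symmetric] power2_eq_square[symmetric] inner_add_left[symmetric])
        also have "\<dots> \<le> (norm (Gm a - x) + e n) * norm ?q"
          using norm_cauchy_schwarz[of "Gm a - x" ?q] l(4)[OF q, of n] by (simp add: algebra_simps)
        finally have "norm ?q \<le> norm (Gm a - x) + e n"
          using epos[of n] by (cases "?q = 0") (simp_all add: add_nonneg_pos less_imp_le)
        then show ?thesis using le_b[OF a, of n] by simp
      qed
      moreover have "(\<lambda>n. norm (Gp a - Gp (b n))) \<longlonglongrightarrow> norm (Gp a - y)"
        using y by (intro tendsto_intros)
      moreover have "(\<lambda>n. norm (Gm a - x) + e n) \<longlonglongrightarrow> norm (Gm a - x) + 0"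
        using l(3) by (intro tendsto_intros)
      ultimately have "norm (Gp a - y) \<le> norm (Gm a - x)"
        by (metis (no_types, lifting) LIMSEQ_le add_0_right)
      then show "norm (Gp (w - a)) \<le> norm (Gm (w - a))"
        using a E(2) w by (simp add: Gp_diff Gm_diff subset_iff norm_minus_commute)
    qed
    then show ?thesis using w by auto
  qed
  then show ?thesis by blast
qed

text \<open>On \<open>E\<close> the value of \<open>Gp\<close> depends only on that of
  \<open>Gm\<close>, so any section \<open>s\<close> of \<open>Gm\<close> on \<open>E\<close>
  defines \<open>\<Phi>\<close>. Linearity is left for later, where it is proved over the original
  scalars.\<close>

lemma contraction_if_m_dissipative:
  assumes E: "subspace E" "E \<subseteq> D" and diss: "\<And>w. w \<in> E \<Longrightarrow> A w \<bullet> w \<le> 0"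
    and onto: "(\<lambda>w. w - A w) ` E = UNIV"
  shows "\<exists>\<Phi>. (\<forall>x. norm (\<Phi> x) \<le> norm x) \<and> E = {w \<in> D. \<Phi> (Gm w) = Gp w}"
proof -
  have le: "norm (Gp w) \<le> norm (Gm w)" if "w \<in> E" for w
    using dissipative_at_iff[of w] diss[OF that] that E(2) by blast
  define s where "s = inv_into E Gm"
  have s: "s x \<in> E" "Gm (s x) = x" for x
    using Gm_onto_if_m_dissipative[OF assms] by (simp_all add: s_def inv_into_into f_inv_into_f)
  have eq: "Gp (s (Gm w)) = Gp w" if "w \<in> E" for w
    using le[OF subspace_diff[OF E(1) s(1) that], of "Gm w"] s[of "Gm w"] that E(2)
    by (simp add: Gp_diff Gm_diff subset_iff)
  \<comment> \<open>Here \<open>w\<close> has the same boundary values as \<open>s (Gm w)\<close>,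
    an element of \<open>E\<close>, so the estimate for \<open>s (Gm w) - b\<close> carries over to
    \<open>w - b\<close>.\<close>
  have "w \<in> E" if w: "w \<in> D" "Gp (s (Gm w)) = Gp w" for w
  proof (rule mem_if_maximal[OF onto E(2) w(1)])
    fix b assume b: "b \<in> E"
    show "norm (Gp (w - b)) \<le> norm (Gm (w - b))"
      using le[OF subspace_diff[OF E(1) s(1) b], of "Gm w"] s[of "Gm w"] b w E(2)
      by (simp add: Gp_diff Gm_diff subset_iff)
  qed
  then have "E = {w \<in> D. Gp (s (Gm w)) = Gp w}" using eq E(2) by auto
  moreover have "norm (Gp (s x)) \<le> norm x" for x using le[OF s(1), of x] s(2) by simp
  ultimately show ?thesis by (intro exI[of _ "\<lambda>x. Gp (s x)"]) simp
qed

end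

subsection \<open>Reduction to real inner products\<close>

lemma to_complex_0 [simp]: "to_complex 0 = 0"
  using to_complex_add[of 0 0] by simp

lemma to_complex_minus [simp]: "to_complex (- a) = - to_complex a"
  using to_complex_add[of a "- a"] by (simp add: eq_neg_iff_add_eq_0 add.commute)

lemma to_complex_diff [simp]: "to_complex (a - b) = to_complex a - to_complex b"
  using to_complex_add[of a "- b"] by simp

lemma to_complex_eq_0_iff [simp]: "to_complex a = 0 \<longleftrightarrow> a = 0"
proof
  assume "to_complex a = 0"
  then have "to_complex (a * inverse a) = 0" by (simp add: to_complex_mult)
  then show "a = 0" by (metis right_inverse to_complex_one zero_neq_one)
qed simp

lemma exists_real_scalar: "\<exists>c::'k::real_or_complex. to_complex c = of_real r"
proof -
  have "complex_of_real r \<in> range (to_complex :: 'k \<Rightarrow> complex)"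
    using range_to_complex[where ?'a = 'k] by auto
  then show ?thesis by (metis imageE)
qed

text \<open>For real scalars \<open>c = 1\<close> suffices; for complex ones \<open>c\<close> is the
  conjugate of the difference, which produces its squared modulus.\<close>

lemma real_or_complex_eqI:
  fixes a b :: "'k::real_or_complex"
  assumes "\<And>c::'k. Re (to_complex c * to_complex a) = Re (to_complex c * to_complex b)"
  shows "a = b"
proof -
  define z where "z = to_complex (a - b)"
  have z: "Re (to_complex c * z) = 0" for c :: 'k
    using assms[of c] by (simp add: z_def algebra_simps)
  consider "range (to_complex :: 'k \<Rightarrow> complex) = \<real>" | "range (to_complex :: 'k \<Rightarrow> complex) = UNIV"
    using range_to_complex[where ?'a = 'k] by blast
  then have "z = 0"
  proof cases
    case 1
    then have "z \<in> \<real>" unfolding z_def by (metis rangeI)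
    then show ?thesis using z[of 1] by (simp add: to_complex_one complex_is_Real_iff complex_eq_iff)
  next
    case 2
    then obtain c :: 'k where c: "to_complex c = cnj z" by (metis UNIV_I imageE)
    have "Re (cnj z * z) = (cmod z)\<^sup>2"
      unfolding cmod_power2 by (simp add: power2_eq_square)
    then have "(cmod z)\<^sup>2 = 0" using z[of c] unfolding c by argo
    then show ?thesis by simp
  qed
  then show ?thesis unfolding z_def to_complex_eq_0_iff by simp
qed

context pre_hilbert_space
begin

lemma inner_scale_left: "scl c x \<bullet> y = Re (to_complex c * to_complex (ip x y))"
  by (simp add: re_ip[symmetric] ip_scale_left to_complex_mult)

lemma inner_scale_right: "x \<bullet> scl c y = Re (to_complex c * cnj (to_complex (ip x y)))"
  by (metis inner_commute inner_scale_left ip_conj_sym)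

lemma scale_eq_scaleR:
  assumes "to_complex c = of_real r" shows "scl c x = r *\<^sub>R x"
proof -
  have "(scl c x - r *\<^sub>R x) \<bullet> y = 0" for y
    using assms by (simp add: inner_diff_left inner_scale_left re_ip)
  from this[of "scl c x - r *\<^sub>R x"] show ?thesis by simp
qed

lemma real_subspace_if_subspace: "subspace S \<Longrightarrow> Real_Vector_Spaces.subspace S"
  unfolding subspace_def Real_Vector_Spaces.subspace_def
  by (metis exists_real_scalar scale_eq_scaleR)

text \<open>As \<open>dom T\<close> is invariant under all scalars, the real identity at
  \<open>scl c u\<close> tests the full one. The adjoint can thus be computed with the real inner
  product.\<close>

lemma ip_eq_iff_inner_eq:
  assumes T: "operator scl T"
  shows "(\<forall>u\<in>dom T. ip (the (T u)) v = ip u w) \<longleftrightarrow> (\<forall>u\<in>dom T. the (T u) \<bullet> v = u \<bullet> w)"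
proof
  assume inner: "\<forall>u\<in>dom T. the (T u) \<bullet> v = u \<bullet> w"
  show "\<forall>u\<in>dom T. ip (the (T u)) v = ip u w"
  proof
    fix u assume u: "u \<in> dom T"
    show "ip (the (T u)) v = ip u w"
    proof (rule real_or_complex_eqI)
      fix c
      have cu: "scl c u \<in> dom T" "the (T (scl c u)) = scl c (the (T u))"
        using T u by (auto simp: operator_def linear_on_def subspace_def)
      have "the (T (scl c u)) \<bullet> v = scl c u \<bullet> w" using inner cu(1) by blast
      then show "Re (to_complex c * to_complex (ip (the (T u)) v)) =
          Re (to_complex c * to_complex (ip u w))"
        unfolding cu(2) inner_scale_left .
    qed
  qed
qed (metis re_ip)

text \<open>Two solutions differ by a vector orthogonal to the dense set \<open>dom T\<close>, hence
  agree, so \<open>THE\<close> in \<open>adjoint_op\<close> picks the solution whenever one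
  exists.\<close>

lemma neg_adjoint_eq_Some_iff:
  assumes T: "operator scl T" and dense: "densely_defined T"
  shows "neg_adjoint ip T v = Some w \<longleftrightarrow> (\<forall>u\<in>dom T. the (T u) \<bullet> v + u \<bullet> w = 0)"
proof -
  let ?P = "\<lambda>w. \<forall>u\<in>dom T. the (T u) \<bullet> v = u \<bullet> w"
  have unique: "w1 = w2" if "?P w1" "?P w2" for w1 w2
  proof -
    have "closed {u. u \<bullet> (w1 - w2) = 0}"
      by (intro closed_Collect_eq continuous_intros)
    moreover have "dom T \<subseteq> {u. u \<bullet> (w1 - w2) = 0}"
    proof
      fix u assume "u \<in> dom T"
      then have "u \<bullet> w1 = u \<bullet> w2" using that by metis
      then show "u \<in> {u. u \<bullet> (w1 - w2) = 0}" by (simp add: inner_diff_right)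
    qed
    ultimately have "closure (dom T) \<subseteq> {u. u \<bullet> (w1 - w2) = 0}"
      by (simp add: closure_minimal)
    then have "w1 - w2 \<in> {u. u \<bullet> (w1 - w2) = 0}"
      using dense unfolding densely_defined_def by blast
    then show ?thesis by simp
  qed
  define w' where "w' = - w"
  have eq: "adjoint_op ip T v = (if \<exists>w. ?P w then Some (THE w. ?P w) else None)"
    unfolding adjoint_op_def ip_eq_iff_inner_eq[OF T] ..
  have the: "(THE w. ?P w) = x" if "?P x" for x
    by (rule the_equality[of ?P, OF that]) (rule unique[OF _ that])
  have "adjoint_op ip T v = Some w' \<longleftrightarrow> ?P w'"
  proof
    assume Some: "adjoint_op ip T v = Some w'"
    then obtain x where x: "?P x" unfolding eq by (auto split: if_splits)
    then have "adjoint_op ip T v = Some x" unfolding eq the[OF x] by (intro if_P exI)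
    then show "?P w'" using Some x by simp
  next
    assume x: "?P w'"
    then show "adjoint_op ip T v = Some w'" unfolding eq the[OF x] by (intro if_P exI)
  qed
  moreover have "neg_adjoint ip T v = Some w \<longleftrightarrow> adjoint_op ip T v = Some w'"
    unfolding neg_adjoint_def w'_def by (cases "adjoint_op ip T v") auto
  ultimately have "neg_adjoint ip T v = Some w \<longleftrightarrow> ?P (- w)" unfolding w'_def by blast
  then show ?thesis by (simp add: eq_neg_iff_add_eq_0)
qed

text \<open>The real locale yields only real homogeneity of \<open>A\<close>; the full one is needed
  for the domain of \<open>A\<^sub>\<Phi>\<close> to be a subspace over \<open>'k\<close>.\<close>

lemma neg_adjoint_scale:
  assumes T: "operator scl T" and dense: "densely_defined T"
    and v: "neg_adjoint ip T v = Some w"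
  shows "neg_adjoint ip T (scl c v) = Some (scl c w)"
proof -
  have "\<forall>u\<in>dom T. the (T u) \<bullet> v = u \<bullet> - w"
    using v unfolding neg_adjoint_eq_Some_iff[OF T dense] by (simp add: eq_neg_iff_add_eq_0)
  then have ip: "\<forall>u\<in>dom T. ip (the (T u)) v = ip u (- w)"
    unfolding ip_eq_iff_inner_eq[OF T] .
  have "the (T u) \<bullet> scl c v = u \<bullet> scl c (- w)" if "u \<in> dom T" for u
    unfolding inner_scale_right using ip that by simp
  then show ?thesis
    unfolding neg_adjoint_eq_Some_iff[OF T dense] by simp
qed

end

lemma linear_on_scaleR:
  fixes s1 :: "'k::real_or_complex \<Rightarrow> 'v::real_inner \<Rightarrow> 'v"
    and s2 :: "'k \<Rightarrow> 'w::real_inner \<Rightarrow> 'w"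
  assumes "pre_hilbert_space s1 ip1" "pre_hilbert_space s2 ip2" "linear_on s1 s2 D f" "x \<in> D"
  shows "f (r *\<^sub>R x) = r *\<^sub>R f x"
proof -
  obtain c :: 'k where "to_complex c = of_real r" using exists_real_scalar by blast
  then have "s1 c x = r *\<^sub>R x" "s2 c (f x) = r *\<^sub>R f x"
    using assms pre_hilbert_space.scale_eq_scaleR by blast+
  then show ?thesis using assms(3,4) unfolding linear_on_def by metis
qed

lemma linear_if_linear_over_scalars:
  assumes s: "pre_hilbert_space s1 ip1" "pre_hilbert_space s2 ip2" and f: "Vector_Spaces.linear s1 s2 f"
  shows "linear f"
proof -
  interpret f: Vector_Spaces.linear s1 s2 f by (rule f)
  have "linear_on s1 s2 UNIV f" by (simp add: linear_on_def f.add f.scale)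
  then show ?thesis
    using linear_on_scaleR[OF s] by (intro linearI) (auto simp: f.add)
qed

lemma affine_bounded_above_imp_const:
  fixes a b :: real
  assumes "\<And>t. a + t * b \<le> 0" shows "b = 0"
proof (rule ccontr)
  assume "b \<noteq> 0"
  then show False using assms[of "(1 - a) / b"] by simp
qed

section \<open>The bijection over the original scalar field\<close>

theorem corollary3p12:
  fixes scl :: "'k::real_or_complex \<Rightarrow> 'v::{real_inner,complete_space} \<Rightarrow> 'v"
    and ip :: "'v \<Rightarrow> 'v \<Rightarrow> 'k"
    and A0 :: "'v \<rightharpoonup> 'v"
    and scl_m :: "'k \<Rightarrow> 'm::real_inner \<Rightarrow> 'm"
    and ip_m :: "'m \<Rightarrow> 'm \<Rightarrow> 'k"
    and scl_p :: "'k \<Rightarrow> 'p::real_inner \<Rightarrow> 'p"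
    and ip_p :: "'p \<Rightarrow> 'p \<Rightarrow> 'k"
    and Gm :: "'v \<Rightarrow> 'm"
    and Gp :: "'v \<Rightarrow> 'p"
  assumes "pre_hilbert_space scl ip"
    and "operator scl A0"
    and "densely_defined A0"
    and "skew_symmetric ip A0"
    and "boundary_quadruple scl ip A0 scl_m ip_m scl_p ip_p Gm Gp"
  shows "bij_betw (boundary_restriction ip A0 Gm Gp)
           {\<Phi>. linear_contraction scl_m scl_p \<Phi>}
           {B. operator scl B \<and> A0 \<subseteq>\<^sub>m B \<and> m_dissipative ip B}"
proof -
  define AA where "AA = neg_adjoint ip A0"
  define D where "D = dom AA"
  define A where "A x = the (AA x)" for x
  interpret V: pre_hilbert_space scl ip by fact
  have quadruple:
    "pre_hilbert_space scl_m ip_m" "pre_hilbert_space scl_p ip_p"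
    "linear_on scl scl_m D Gm" "Gm ` D = UNIV" "linear_on scl scl_p D Gp" "Gp ` D = UNIV"
    "\<And>u v. u \<in> D \<Longrightarrow> v \<in> D \<Longrightarrow> ip (A u) v + ip u (A v) = ip_p (Gp u) (Gp v) - ip_m (Gm u) (Gm v)"
    "{x + y |x y. x \<in> ker_on D Gm \<and> y \<in> ker_on D Gp} = D"
    using assms(5) unfolding boundary_quadruple_def Let_def AA_def D_def A_def by blast+
  interpret M: pre_hilbert_space scl_m ip_m by fact
  interpret P: pre_hilbert_space scl_p ip_p by fact
  have AA_eq_Some_iff: "AA v = Some w \<longleftrightarrow> v \<in> D \<and> A v = w" for v w
    by (auto simp: D_def A_def)
  have AA_iff: "AA v = Some w \<longleftrightarrow> (\<forall>u\<in>dom A0. the (A0 u) \<bullet> v + u \<bullet> w = 0)" for v w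
    unfolding AA_def using assms(2,3) by (rule V.neg_adjoint_eq_Some_iff)
  have skew: "the (A0 u) \<bullet> v + u \<bullet> the (A0 v) = 0" if "u \<in> dom A0" "v \<in> dom A0" for u v
  proof -
    have "ip (the (A0 u)) v + ip u (the (A0 v)) = 0"
      using assms(4) that by (auto simp: skew_symmetric_def)
    then have "Re (to_complex (ip (the (A0 u)) v + ip u (the (A0 v)))) = 0" by simp
    then show ?thesis by (simp add: to_complex_add V.re_ip)
  qed
  then have A0: "u \<in> D" "A u = the (A0 u)" if "u \<in> dom A0" for u
    using that AA_iff AA_eq_Some_iff by blast+
  have A_scale: "scl c v \<in> D \<and> A (scl c v) = scl c (A v)" if "v \<in> D" for c v
    using V.neg_adjoint_scale[OF assms(2,3), of v "A v" c] that AA_eq_Some_iff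
    unfolding AA_def[symmetric] by blast
  interpret Q: real_boundary_quadruple "dom A0" D A Gm Gp
  proof
    show "v \<in> D \<and> A v = w \<longleftrightarrow> (\<forall>u\<in>dom A0. A u \<bullet> v + u \<bullet> w = 0)" for v w
      using AA_iff AA_eq_Some_iff A0(2) by metis
    show "dom A0 \<subseteq> D" using A0(1) by blast
    show "A u \<bullet> v + u \<bullet> A v = Gp u \<bullet> Gp v - Gm u \<bullet> Gm v" if "u \<in> D" "v \<in> D" for u v
      using quadruple(7)[OF that]
      by (metis (no_types) V.re_ip M.re_ip P.re_ip to_complex_add to_complex_diff
          plus_complex.sel(1) minus_complex.sel(1))
    show "\<exists>x\<in>D. \<exists>y\<in>D. Gm x = 0 \<and> Gp y = 0 \<and> u = x + y" if "u \<in> D" for u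
    proof -
      have "u \<in> {x + y |x y. x \<in> ker_on D Gm \<and> y \<in> ker_on D Gp}"
        using quadruple(8) that by simp
      then show ?thesis unfolding ker_on_def by blast
    qed
    show "Gm (r *\<^sub>R u) = r *\<^sub>R Gm u" if "u \<in> D" for r u
      by (rule linear_on_scaleR[OF assms(1) quadruple(1,3) that])
    show "Gp (r *\<^sub>R u) = r *\<^sub>R Gp u" if "u \<in> D" for r u
      by (rule linear_on_scaleR[OF assms(1) quadruple(2,5) that])
  qed (use quadruple(3-6) in \<open>auto simp: linear_on_def\<close>)
  let ?E = "\<lambda>\<Phi>. {w \<in> D. \<Phi> (Gm w) = Gp w}"
  have restriction: "boundary_restriction ip A0 Gm Gp \<Phi> = AA |` ?E \<Phi>" for \<Phi>
    by (simp add: boundary_restriction_def AA_def D_def Let_def)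
  have dom_restriction: "dom (AA |` ?E \<Phi>) = ?E \<Phi>" for \<Phi>
    by (auto simp: D_def)
  have Gm_scl: "Gm (scl c w) = scl_m c (Gm w)" "Gp (scl c w) = scl_p c (Gp w)" if "w \<in> D" for c w
    using quadruple(3,5) that by (auto simp: linear_on_def)
  \<comment> \<open>An element with boundary values \<open>x\<close> and \<open>\<Phi> x\<close>
    lies in the first domain; since the domains agree, it forces
    \<open>\<Psi> x = \<Phi> x\<close>.\<close>
  have inj: "\<Phi> = \<Psi>" if "AA |` ?E \<Phi> = AA |` ?E \<Psi>" for \<Phi> \<Psi>
  proof
    fix x
    obtain w where "w \<in> D" "Gm w = x" "Gp w = \<Phi> x" using Q.jointly_surj by meson
    moreover have "?E \<Phi> = ?E \<Psi>" using that dom_restriction by metis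
    then have "w \<in> ?E \<Phi> \<longleftrightarrow> w \<in> ?E \<Psi>" by simp
    ultimately show "\<Phi> x = \<Psi> x" by simp
  qed
  have into: "operator scl (AA |` ?E \<Phi>) \<and> A0 \<subseteq>\<^sub>m AA |` ?E \<Phi> \<and> m_dissipative ip (AA |` ?E \<Phi>)"
    if "linear_contraction scl_m scl_p \<Phi>" for \<Phi>
  proof (intro conjI)
    have lin: "Vector_Spaces.linear scl_m scl_p \<Phi>" and contr: "\<And>x. norm (\<Phi> x) \<le> norm x"
      using that by (auto simp: linear_contraction_def)
    interpret \<Phi>: Vector_Spaces.linear scl_m scl_p \<Phi> by (rule lin)
    have real_lin: "linear \<Phi>" by (rule linear_if_linear_over_scalars[OF quadruple(1,2) lin])
    have "V.subspace (?E \<Phi>)"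
      using Q.zero_D Q.A_add A_scale Gm_scl Q.Gm_scale[OF Q.zero_D, of 0] Q.Gp_scale[OF Q.zero_D, of 0]
      by (auto simp: V.subspace_def Q.Gm_add Q.Gp_add \<Phi>.add \<Phi>.scale \<Phi>.zero)
    moreover have "linear_on scl scl (?E \<Phi>) A"
      using Q.A_add A_scale by (simp add: linear_on_def)
    ultimately show "operator scl (AA |` ?E \<Phi>)"
      unfolding operator_def dom_restriction
      by (auto simp: linear_on_def V.subspace_def A_def)
    show "A0 \<subseteq>\<^sub>m AA |` ?E \<Phi>"
      unfolding map_le_def
    proof
      fix u assume u: "u \<in> dom A0"
      then have "u \<in> ?E \<Phi>" using A0(1) Q.G_eq_0_if_D0[OF u] by (simp add: \<Phi>.zero)
      moreover have "AA u = A0 u" using A0[OF u] u AA_eq_Some_iff by (metis domIff option.exhaust_sel)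
      ultimately show "A0 u = (AA |` ?E \<Phi>) u" by simp
    qed
    have "(\<lambda>x. x - the ((AA |` ?E \<Phi>) x)) ` ?E \<Phi> = (\<lambda>x. x - A x) ` ?E \<Phi>"
      by (intro image_cong refl) (simp add: A_def)
    also have "\<dots> = UNIV"
    proof (rule UNIV_eq_I[symmetric])
      fix f
      obtain w where "w \<in> ?E \<Phi>" "f = w - A w"
        using Q.range_Id_minus_A_contraction[OF real_lin contr, of f] by blast
      then show "f \<in> (\<lambda>x. x - A x) ` ?E \<Phi>" by (rule rev_image_eqI)
    qed
    finally have "(\<lambda>x. x - the ((AA |` ?E \<Phi>) x)) ` ?E \<Phi> = UNIV" .
    moreover have "A w \<bullet> w \<le> 0" if "w \<in> ?E \<Phi>" for w
      using that contr[of "Gm w"] Q.dissipative_at_iff[of w] by simp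
    ultimately show "m_dissipative ip (AA |` ?E \<Phi>)"
      unfolding m_dissipative_def dissipative_def dom_restriction
      by (simp add: V.re_ip A_def)
  qed
  have onto: "\<exists>\<Phi>. linear_contraction scl_m scl_p \<Phi> \<and> B = AA |` ?E \<Phi>"
    if B: "operator scl B" "A0 \<subseteq>\<^sub>m B" "m_dissipative ip B" for B
  proof -
    have sub: "V.subspace (dom B)" and lin: "linear_on scl scl (dom B) (\<lambda>x. the (B x))"
      using B(1) by (auto simp: operator_def)
    note real_sub = V.real_subspace_if_subspace[OF sub]
    have diss: "the (B w) \<bullet> w \<le> 0" if "w \<in> dom B" for w
      using B(3) that by (simp add: m_dissipative_def dissipative_def V.re_ip)
    \<comment> \<open>Dissipativity of \<open>B\<close> at \<open>v + t u\<close> is a bound on a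
      polynomial in \<open>t\<close> whose quadratic term vanishes by skew-symmetry. An affine
      function bounded above has slope zero, and that slope is the adjoint equation.\<close>
    have AA_B: "AA v = B v" if v: "v \<in> dom B" for v
    proof -
      have "the (A0 u) \<bullet> v + u \<bullet> the (B v) = 0" if u: "u \<in> dom A0" for u
      proof (rule affine_bounded_above_imp_const)
        fix t :: real
        have Bu: "u \<in> dom B" "B u = A0 u" using B(2) u by (auto simp: map_le_def dom_def)
        have tu: "t *\<^sub>R u \<in> dom B" by (rule subspace_scale[OF real_sub Bu(1)])
        have "v + t *\<^sub>R u \<in> dom B" by (rule subspace_add[OF real_sub v tu])
        moreover have "the (B (v + t *\<^sub>R u)) = the (B v) + t *\<^sub>R the (A0 u)"
          using lin v tu linear_on_scaleR[OF assms(1) assms(1) lin Bu(1), of t] Bu(2)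
          by (simp add: linear_on_def)
        ultimately have "(the (B v) + t *\<^sub>R the (A0 u)) \<bullet> (v + t *\<^sub>R u) \<le> 0"
          using diss by metis
        moreover have "the (A0 u) \<bullet> u = 0" using skew[OF u u] by (simp add: inner_commute)
        ultimately show "the (B v) \<bullet> v + t * (the (A0 u) \<bullet> v + u \<bullet> the (B v)) \<le> 0"
          by (simp add: inner_add_left inner_add_right algebra_simps inner_commute)
      qed
      then have "AA v = Some (the (B v))" unfolding AA_iff by blast
      then show ?thesis using v by auto
    qed
    have E: "dom B \<subseteq> D" using AA_B unfolding D_def by (metis domIff subsetI)
    have A_B: "A w = the (B w)" if "w \<in> dom B" for w using AA_B[OF that] by (simp add: A_def)
    have "(\<lambda>w. w - A w) ` dom B = (\<lambda>w. w - the (B w)) ` dom B"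
      by (intro image_cong refl) (simp add: A_B)
    then have surj: "(\<lambda>w. w - A w) ` dom B = UNIV"
      using B(3) by (simp add: m_dissipative_def)
    have diss': "A w \<bullet> w \<le> 0" if "w \<in> dom B" for w using diss A_B that by simp
    obtain \<Phi> where contr: "\<And>x. norm (\<Phi> x) \<le> norm x" and dom_B: "dom B = ?E \<Phi>"
      using Q.contraction_if_m_dissipative[OF real_sub E diss' surj] by blast
    have Gm_onto: "\<exists>w\<in>dom B. Gm w = x" for x
    proof -
      have "x \<in> Gm ` dom B"
        using Q.Gm_onto_if_m_dissipative[OF real_sub E diss' surj] by simp
      then show ?thesis by blast
    qed
    have \<Phi>: "\<Phi> (Gm w) = Gp w" "w \<in> D" if "w \<in> dom B" for w using that dom_B by auto
    \<comment> \<open>Every vector of \<open>H_-\<close> is a \<open>Gm\<close> value from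
      \<open>dom B\<close>, so \<open>\<Phi>\<close> inherits linearity from the boundary maps and
      the subspace \<open>dom B\<close>.\<close>
    have "\<Phi> (x + y) = \<Phi> x + \<Phi> y" for x y
    proof -
      obtain a b where ab: "a \<in> dom B" "Gm a = x" "b \<in> dom B" "Gm b = y" using Gm_onto by meson
      then have "a + b \<in> dom B" by (intro V.subspace_add[OF sub])
      then have "\<Phi> (Gm (a + b)) = Gp (a + b)" by (rule \<Phi>)
      then show ?thesis using ab \<Phi>[OF ab(1)] \<Phi>[OF ab(3)] by (simp add: Q.Gm_add Q.Gp_add)
    qed
    moreover have "\<Phi> (scl_m c x) = scl_p c (\<Phi> x)" for c x
    proof -
      obtain a where a: "a \<in> dom B" "Gm a = x" using Gm_onto by meson
      then have "scl c a \<in> dom B" by (intro V.subspace_scale[OF sub])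
      then have "\<Phi> (Gm (scl c a)) = Gp (scl c a)" by (rule \<Phi>)
      then show ?thesis using a \<Phi>[OF a(1)] by (simp add: Gm_scl)
    qed
    ultimately have "Vector_Spaces.linear scl_m scl_p \<Phi>"
      by unfold_locales auto
    moreover have "B = AA |` dom B"
      using AA_B by (auto simp: restrict_map_def fun_eq_iff)
    ultimately show ?thesis
      using contr unfolding dom_B linear_contraction_def by (intro exI[of _ \<Phi>]) simp
  qed
  show ?thesis
  proof (rule bij_betw_imageI)
    show "inj_on (boundary_restriction ip A0 Gm Gp) {\<Phi>. linear_contraction scl_m scl_p \<Phi>}"
      by (rule inj_onI, rule inj) (simp only: restriction)
    show "boundary_restriction ip A0 Gm Gp ` {\<Phi>. linear_contraction scl_m scl_p \<Phi>} =
        {B. operator scl B \<and> A0 \<subseteq>\<^sub>m B \<and> m_dissipative ip B}"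
      unfolding image_def restriction using into onto by blast
  qed
qed

end
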